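(* Let $n$ be a positive integer and let $S\subset\{1,\dots,n\}$ be a symmetric set of representatives mod $n$. Put $x=z^{1/2}-z^{-1/2}$, where $z=e^{2\pi i\sigma}$ and $z^{1/2}=e^{\pi i\sigma}$, and let $|q|<1$. (1) If $n\notin S$, write $S=\{\ell_1,\dots,\ell_s\}$. Then \[\sum_{k=0}^\infty(-1)^kA_{S,n,k}(q)\,x^{2k}=\prod_{j=1}^s\frac{\vartheta_{\alpha(n,\ell_j)}(q^n,-z)}{\vartheta_{\alpha(n,\ell_j)}(q^n)}.\] (2) If $n\in S$, write $S=\{n=\ell_0,\ell_1,\dots,\ell_s\}$. Then \[\sum_{k=0}^\infty(-1)^kA_{S,n,k}(q)\,x^{2k+1}=-i\,\frac{\prod_{j=0}^s\vartheta_{\alpha(n,\ell_j)}(q^n,-z)}{\eta(q^n)^3\prod_{j=1}^s\vartheta_{\alpha(n,\ell_j)}(q^n)}.\]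
   Context: A set $S\subset\{1,\dots,n\}$ is a symmetric set of representatives mod $n$ if for every $\ell\in S$, some element of $S$ is congruent to $-\ell$ mod $n$; "$m\in S\pmod n$" means $m$ is congruent mod $n$ to some element of $S$. Define \[A_{S,n,k}(q)=\sum_{\substack{0<m_1<\cdots<m_k\\ m_i\in S \pmod n}}\frac{q^{m_1+\cdots+m_k}}{(1-q^{m_1})^2\cdots(1-q^{m_k})^2},\] with $A_{S,n,0}=1$. For $1\le\ell\le n$, $\alpha(n,\ell)=\frac{\ell}{n}-\frac12$. For $r\in\mathbb{Q}$, with $q=e^{2\pi i\tau}$, $z=e^{2\pi i\sigma}$, $\vartheta_r(q,z)=\sum_{m\in\mathbb{Z}+r}q^{\frac12m^2}z^m$ (where $z^m=e^{2\pi i m\sigma}$), and $\vartheta_r(q,-z)=\sum_{m\in\mathbb{Z}+r}e^{\pi i m}q^{\frac12 m^2}z^m$; also $\vartheta_r(q)=\vartheta_r(q,-1)=\sum_{m\in\mathbb{Z}+r}e^{\pi i m}q^{\frac12m^2}$. The Dedekind eta function is $\eta(q)=q^{1/24}\prod_{m\ge1}(1-q^m)$ (with $q^{1/24}=e^{2\pi i\tau/24}$). *)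

theory Defs
  imports "HOL-Analysis.Analysis" "HOL-Number_Theory.Cong"
begin

definition symmetric_reps :: "nat \<Rightarrow> nat set \<Rightarrow> bool" where
  "symmetric_reps n S \<longleftrightarrow>
     S \<subseteq> {1..n} \<and> (\<forall>l\<in>S. \<exists>l'\<in>S. [int l' = - int l] (mod int n))"

definition mem_mod :: "nat \<Rightarrow> nat set \<Rightarrow> nat \<Rightarrow> bool" where
  "mem_mod m S n \<longleftrightarrow> (\<exists>l\<in>S. [m = l] (mod n))"

text \<open>A tuple \<open>0 < m\<^sub>1 < \<dots> < m\<^sub>k\<close> is encoded as a strictly increasing list of length \<open>k\<close>.\<close>

definition index_tuples :: "nat set \<Rightarrow> nat \<Rightarrow> nat \<Rightarrow> nat list set" where
  "index_tuples S n k =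
     {ms. length ms = k \<and> sorted_wrt (<) ms \<and> (\<forall>m\<in>set ms. 0 < m \<and> mem_mod m S n)}"

definition A_series :: "nat set \<Rightarrow> nat \<Rightarrow> nat \<Rightarrow> complex \<Rightarrow> complex" where
  "A_series S n k q =
     (\<Sum>\<^sub>\<infinity>ms\<in>index_tuples S n k. q ^ sum_list ms / prod_list (map (\<lambda>m. (1 - q ^ m)\<^sup>2) ms))"

lemma A_series_0 [simp]: "A_series S n 0 q = 1"
proof -
  have "index_tuples S n 0 = {[]}"
    by (auto simp: index_tuples_def)
  thus ?thesis
    by (simp add: A_series_def)
qed

definition alpha :: "nat \<Rightarrow> nat \<Rightarrow> rat" where
  "alpha n l = of_nat l / of_nat n - 1 / 2"

text \<open>
  The theta and eta functions involve fractional powers of \<open>q = exp (2\<pi>i\<tau>)\<close> and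
  \<open>z = exp (2\<pi>i\<sigma>)\<close>, so they are functions of \<open>\<tau>\<close> and \<open>\<sigma>\<close>; the power \<open>q ^ n\<close> corresponds
  to \<open>n \<tau>\<close>, so that \<open>q\<close> raised to \<open>m\<^sup>2 / 2\<close> is \<open>exp (\<pi>i m\<^sup>2 \<tau>)\<close>.
\<close>

definition vartheta :: "rat \<Rightarrow> complex \<Rightarrow> complex \<Rightarrow> complex" where
  "vartheta r \<tau> \<sigma> =
     (\<Sum>\<^sub>\<infinity>m\<in>(\<lambda>k. k + r) ` \<int>.
        exp (2 * pi * \<i> * \<tau> * of_rat (m\<^sup>2 / 2)) * exp (2 * pi * \<i> * of_rat m * \<sigma>))"

text \<open>\<open>\<vartheta>\<^sub>r(q, -z)\<close>, where the power of \<open>-1\<close> with exponent \<open>m\<close> is read as \<open>exp (\<pi>i m)\<close>.\<close>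

definition vartheta_neg :: "rat \<Rightarrow> complex \<Rightarrow> complex \<Rightarrow> complex" where
  "vartheta_neg r \<tau> \<sigma> =
     (\<Sum>\<^sub>\<infinity>m\<in>(\<lambda>k. k + r) ` \<int>.
        exp (pi * \<i> * of_rat m) * exp (2 * pi * \<i> * \<tau> * of_rat (m\<^sup>2 / 2))
          * exp (2 * pi * \<i> * of_rat m * \<sigma>))"

lemma vartheta_neg_eq: "vartheta_neg r \<tau> \<sigma> = vartheta r \<tau> (\<sigma> + 1 / 2)"
  unfolding vartheta_neg_def vartheta_def
  by (intro infsum_cong) (simp add: exp_add [symmetric] algebra_simps)

text \<open>\<open>\<vartheta>\<^sub>r(q) = \<vartheta>\<^sub>r(q, -1)\<close>: here \<open>z = 1\<close> is taken with \<open>\<sigma> = 0\<close>.\<close>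

definition vartheta_null :: "rat \<Rightarrow> complex \<Rightarrow> complex" where
  "vartheta_null r \<tau> = vartheta_neg r \<tau> 0"

definition dedekind_eta :: "complex \<Rightarrow> complex" where
  "dedekind_eta \<tau> =
     exp (2 * pi * \<i> * \<tau> / 24) * (\<Prod>m. 1 - exp (2 * pi * \<i> * \<tau>) ^ Suc m)"

end

theory Submission
  imports Defs
begin

text \<open>
  Write \<open>Q = q ^ n\<close>. Since \<open>x\<^sup>2 = z + 1 / z - 2\<close>, we have
  \<open>(1 - z q\<^sup>m) (1 - q\<^sup>m / z) / (1 - q\<^sup>m)\<^sup>2 = 1 - x\<^sup>2 q\<^sup>m / (1 - q\<^sup>m)\<^sup>2\<close>, so expanding the product of these
  factors over all \<open>m\<close> in \<open>S\<close> mod \<open>n\<close> as a sum over finite sets of indices \<open>m\<close>, and grouping by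
  cardinality, gives the generating function of the series \<open>A\<close>. On the other side, the Jacobi triple
  product with \<open>w = z q\<^sup>l\<close> turns each theta function into an elementary exponential times
  \<open>\<Prod>(1 - Q\<^sup>j) \<Prod>(1 - z q\<^sup>m) \<Prod>(1 - q\<^bsup>m'\<^esup> / z)\<close>, with \<open>m \<equiv> l\<close> and \<open>m' \<equiv> -l\<close>. Symmetry of \<open>S\<close> lets
  one exchange \<open>l\<close> and \<open>n - l\<close> in the last factor and makes the powers of \<open>z\<close> cancel. The class
  \<open>l = n\<close> contributes the extra factor \<open>z\<^bsup>1/2\<^esup> (1 - 1 / z) = x\<close> and the power of \<open>\<eta>\<close>.

  The triple product itself is the limit of its finite version, whose coefficients are the
  \<open>q\<close>-binomials \<open>[2N, N + k]\<close>; these are bounded uniformly in \<open>N\<close> and \<open>k\<close>, so dominated convergence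
  applies.
\<close>

subsection \<open>The Jacobi triple product\<close>

text \<open>Dominated convergence for unordered sums. The majorant \<open>M\<close> makes the finite
  partial sums converge uniformly in \<open>N\<close>, so the limit in \<open>N\<close> may be
  exchanged with the limit over finite subsets of \<open>A\<close>.\<close>

lemma tendsto_has_sum_dominated:
  fixes f :: "nat \<Rightarrow> 'a \<Rightarrow> 'b :: banach"
  assumes f: "\<And>N. (f N has_sum s N) A"
    and lim: "\<And>k. k \<in> A \<Longrightarrow> (\<lambda>N. f N k) \<longlonglongrightarrow> g k"
    and bound: "\<And>N k. k \<in> A \<Longrightarrow> norm (f N k) \<le> M k"
    and M: "M summable_on A"
    and s: "s \<longlonglongrightarrow> l"
  shows "(g has_sum l) A"
proof -
  have norm_g: "norm (g k) \<le> M k" if "k \<in> A" for k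
    by (rule Lim_bounded[OF tendsto_norm[OF lim[OF that]], of 0]) (use bound that in auto)
  have "g summable_on A"
    by (rule abs_summable_summable[OF Infinite_Sum.abs_summable_on_comparison_test'[OF M norm_g]])
  then have g: "(g has_sum infsum g A) A"
    by simp
  have "s \<longlonglongrightarrow> infsum g A"
  proof (rule swap_uniform_limit')
    show "\<forall>\<^sub>F X in finite_subsets_at_top A. (\<lambda>N. \<Sum>k\<in>X. f N k) \<longlonglongrightarrow> (\<Sum>k\<in>X. g k)"
      by (rule eventually_finite_subsets_at_top_weakI) (auto intro!: tendsto_sum lim)
    show "(sum g \<longlongrightarrow> infsum g A) (finite_subsets_at_top A)"
      using g by (simp add: has_sum_def)
    show "uniform_limit UNIV (\<lambda>X N. \<Sum>k\<in>X. f N k) s (finite_subsets_at_top A)"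
      by (rule Weierstrass_m_test_general'[OF _ f M]) (use bound in auto)
  qed auto
  with s have "l = infsum g A"
    using LIMSEQ_unique by blast
  with g show ?thesis by simp
qed

section \<open>Gaussian binomial coefficients and their Pascal recurrences\<close>

definition qfact :: "'a :: field \<Rightarrow> nat \<Rightarrow> 'a" where
  "qfact q n = (\<Prod>i<n. 1 - q ^ Suc i)"

text \<open>The lower index is an integer and the value vanishes outside the range, so the
  recurrences hold for every \<open>k\<close> and a finite expansion can be summed over all
  integers.\<close>

definition qbinomial :: "'a :: field \<Rightarrow> nat \<Rightarrow> int \<Rightarrow> 'a" where
  "qbinomial q n k =
     (if 0 \<le> k \<and> k \<le> int n then qfact q n / (qfact q (nat k) * qfact q (nat (int n - k))) else 0)"

lemma qfact_0 [simp]: "qfact q 0 = 1"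
  by (simp add: qfact_def)

lemma qfact_Suc: "qfact q (Suc n) = qfact q n * (1 - q ^ Suc n)"
  by (simp add: qfact_def)

context
  fixes q :: "'a :: field"
  assumes not_root: "\<And>i. i > 0 \<Longrightarrow> q ^ i \<noteq> 1"
begin

lemma qfact_nonzero: "qfact q n \<noteq> 0"
proof -
  have "1 - q ^ Suc i \<noteq> 0" for i
    using not_root[of "Suc i"] by (metis eq_iff_diff_eq_0 zero_less_Suc)
  then show ?thesis
    by (simp add: qfact_def del: power_Suc)
qed

text \<open>When \<open>k\<close> exceeds \<open>n + 1\<close> the exponent truncates to 0, which
  does no harm because its coefficient vanishes there.\<close>

lemma qbinomial_Suc:
  "qbinomial q (Suc n) k = qbinomial q n k + q ^ nat (int n + 1 - k) * qbinomial q n (k - 1)"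
proof -
  consider "k < 0" | "k = 0" | "k = int n + 1" | "k > int n + 1" | "0 < k" "k \<le> int n"
    by linarith
  then show ?thesis
  proof cases
    case 5
    define j d where "j = nat (k - 1)" and "d = nat (int n - k)"
    have k: "k = int (Suc j)" and n: "n = Suc j + d"
      using 5 by (auto simp: j_def d_def)
    have nz: "1 - q ^ Suc i \<noteq> 0" for i
      using not_root[of "Suc i"] by simp
    have *: "nat (int (Suc n) - k) = Suc d" "nat (int n - k) = d" "nat (int n - (k - 1)) = Suc d"
      "nat (int n + 1 - k) = Suc d" "nat (k - 1) = j" "nat k = Suc j"
      "nat (1 + int n - k) = Suc d"
      unfolding k n by auto
    have "qbinomial q (Suc n) k = qfact q n * (1 - q ^ Suc n) / (qfact q (Suc j) * qfact q (Suc d))"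
      using 5 by (simp add: qbinomial_def * qfact_Suc[of _ n])
    \<comment> \<open>This splitting produces the two terms: the first summand cancels the last
      factor of \<open>qfact q (Suc d)\<close>, the second that of
      \<open>qfact q (Suc j)\<close>.\<close>
    also have "1 - q ^ Suc n = (1 - q ^ Suc d) + q ^ Suc d * (1 - q ^ Suc j)"
      by (simp add: n power_add algebra_simps)
    also have "qfact q n * \<dots> / (qfact q (Suc j) * qfact q (Suc d)) =
        qfact q n / (qfact q (Suc j) * qfact q d) + q ^ Suc d * (qfact q n / (qfact q j * qfact q (Suc d)))"
      using nz[of j] nz[of d] qfact_nonzero[of j] qfact_nonzero[of d]
      unfolding qfact_Suc by (simp add: divide_simps del: power_Suc) (simp add: algebra_simps)
    also have "\<dots> = qbinomial q n k + q ^ nat (int n + 1 - k) * qbinomial q n (k - 1)"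
      using 5 by (simp add: qbinomial_def * del: power_Suc)
    finally show ?thesis .
  qed (auto simp: qbinomial_def qfact_nonzero nat_add_distrib)
qed

lemma qbinomial_symmetric: "qbinomial q n (int n - k) = qbinomial q n k"
  by (auto simp: qbinomial_def mult.commute)

text \<open>The mirror image of the first recurrence under \<open>k\<close> to
  \<open>n + 1 - k\<close>. One recurrence adds factors in \<open>w\<close>, the other factors in
  \<open>1 / w\<close>.\<close>

lemma qbinomial_Suc':
  "qbinomial q (Suc n) k = qbinomial q n (k - 1) + q ^ nat k * qbinomial q n k"
  using qbinomial_Suc[of n "int (Suc n) - k"] qbinomial_symmetric[of "Suc n" k]
    qbinomial_symmetric[of n k] qbinomial_symmetric[of n "k - 1"]
  by (simp add: algebra_simps)

end

text \<open>Since \<open>k * (k - 1)\<close> is even and nonnegative for every integer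
  \<open>k\<close>, neither \<open>div\<close> nor \<open>nat\<close> loses anything. A natural
  exponent keeps \<open>q = 0\<close> meaningful.\<close>

definition triangular :: "int \<Rightarrow> nat" where
  "triangular k = nat (k * (k - 1) div 2)"

lemma of_nat_triangular: "2 * int (triangular k) = k * (k - 1)"
proof -
  have "k * (k - 1) \<ge> 0"
    by (cases "k \<ge> 1") (auto simp: mult_nonneg_nonneg mult_nonpos_nonpos)
  moreover have "even (k * (k - 1))" by simp
  ultimately show ?thesis
    by (simp add: triangular_def)
qed

lemma triangular_shift: "int (triangular (k + 1)) = int (triangular k) + k"
  using of_nat_triangular[of k] of_nat_triangular[of "k + 1"] by (simp add: algebra_simps)

lemma has_sum_int_shift:
  fixes f :: "int \<Rightarrow> 'a :: {comm_monoid_add, topological_space}"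
  shows "((\<lambda>k. f (k + c)) has_sum s) UNIV \<longleftrightarrow> (f has_sum s) UNIV"
  by (rule has_sum_reindex_bij_witness[of _ "\<lambda>k. k - c" "\<lambda>k. k + c"]) auto

text \<open>Independent lengths \<open>a\<close> and \<open>b\<close> allow induction one factor at
  a time. A new factor adds to the series a multiple of its own shift by one, and comparing
  coefficients is exactly one Pascal recurrence.\<close>

lemma finite_jacobi_triple_product:
  fixes q w :: "'a :: {real_normed_field}"
  assumes not_root: "\<And>i. i > 0 \<Longrightarrow> q ^ i \<noteq> 1" and w: "w \<noteq> 0"
  shows "((\<lambda>k. (-w) powi k * q ^ triangular k * qbinomial q (a + b) (int b + k)) has_sum
           (\<Prod>j<a. 1 - w * q ^ j) * (\<Prod>j<b. 1 - q ^ Suc j / w)) UNIV"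
proof -
  define t where "t a b k = (-w) powi k * q ^ triangular k * qbinomial q (a + b) (int b + k)"
    for a b :: nat and k :: int
  have "(t a b has_sum (\<Prod>j<a. 1 - w * q ^ j) * (\<Prod>j<b. 1 - q ^ Suc j / w)) UNIV"
  proof (induction a)
    case 0
    show ?case
    proof (induction b)
      case 0
      have "(t 0 0 has_sum 1) UNIV"
        by (rule has_sum_finite_neutralI[where B = "{0}"])
          (auto simp: t_def qbinomial_def triangular_def)
      then show ?case by simp
    next
      case (Suc b)
      have "t 0 (Suc b) k = t 0 b k + (- (q ^ Suc b / w)) * t 0 b (k + 1)" for k
      proof -
        have "q ^ triangular k * (q ^ nat (int (Suc b) + k) * qbinomial q b (int (Suc b) + k))
            = q ^ triangular (k + 1) * q ^ Suc b * qbinomial q b (int (Suc b) + k)"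
        \<comment> \<open>The exponents add up only where \<open>nat\<close> does not truncate;
          elsewhere both sides carry a vanishing coefficient.\<close>
        proof (cases "int (Suc b) + k \<ge> 0")
          case True
          then have "triangular k + nat (int (Suc b) + k) = triangular (k + 1) + Suc b"
            using triangular_shift[of k] by linarith
          then show ?thesis
            by (metis power_add mult.assoc)
        qed (simp add: qbinomial_def)
        moreover have "(-w) powi (k + 1) * (- (q ^ Suc b / w)) = (-w) powi k * q ^ Suc b"
          using w by (simp add: power_int_add_1)
        moreover have "qbinomial q (Suc b) (int (Suc b) + k) =
            qbinomial q b (int b + k)
              + q ^ nat (int (Suc b) + k) * qbinomial q b (int (Suc b) + k)"
          using qbinomial_Suc'[OF not_root, of b "int (Suc b) + k"] by (simp add: algebra_simps)
        ultimately have "t 0 (Suc b) k = t 0 b k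
            + (-w) powi (k + 1) * (- (q ^ Suc b / w)) * q ^ triangular (k + 1)
              * qbinomial q b (int (Suc b) + k)"
          unfolding t_def by (simp add: algebra_simps)
        also have "\<dots> = t 0 b k + (- (q ^ Suc b / w)) * t 0 b (k + 1)"
          unfolding t_def by (simp add: algebra_simps)
        finally show ?thesis .
      qed
      then have "t 0 (Suc b) = (\<lambda>k. t 0 b k + (- (q ^ Suc b / w)) * t 0 b (k + 1))"
        by (rule ext)
      moreover have "((\<lambda>k. t 0 b k + (- (q ^ Suc b / w)) * t 0 b (k + 1)) has_sum
        (\<Prod>j<b. 1 - q ^ Suc j / w) + (- (q ^ Suc b / w)) * (\<Prod>j<b. 1 - q ^ Suc j / w)) UNIV"
        using Suc.IH by (intro has_sum_add has_sum_cmult_right) (simp_all add: has_sum_int_shift)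
      ultimately have "(t 0 (Suc b) has_sum
          (\<Prod>j<b. 1 - q ^ Suc j / w) + (- (q ^ Suc b / w)) * (\<Prod>j<b. 1 - q ^ Suc j / w)) UNIV"
        by simp
      then show ?case
        by (simp add: algebra_simps)
    qed
  next
    case (Suc a)
    let ?P = "(\<Prod>j<a. 1 - w * q ^ j) * (\<Prod>j<b. 1 - q ^ Suc j / w)"
    \<comment> \<open>Multiplication by \<open>w\<close> raises the exponent by one. The identity is
      stated at \<open>k + 1\<close> and the sum is shifted back afterwards.\<close>
    have "t (Suc a) b (k + 1) = t a b (k + 1) + (- (w * q ^ a)) * t a b k" for k
    proof -
      have "q ^ triangular (k + 1) * (q ^ nat (int a - k) * qbinomial q (a + b) (int b + k))
          = q ^ triangular k * q ^ a * qbinomial q (a + b) (int b + k)"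
      proof (cases "k \<le> int a")
        case True
        then have "triangular (k + 1) + nat (int a - k) = triangular k + a"
          using triangular_shift[of k] by linarith
        then show ?thesis
          by (metis power_add mult.assoc)
      qed (simp add: qbinomial_def)
      moreover have "(-w) powi (k + 1) = (-w) powi k * (-w)"
        using w by (simp add: power_int_add_1)
      moreover have "qbinomial q (Suc a + b) (int b + (k + 1)) =
          qbinomial q (a + b) (int b + (k + 1)) + q ^ nat (int a - k) * qbinomial q (a + b) (int b + k)"
        using qbinomial_Suc[OF not_root, of "a + b" "int b + (k + 1)"] by (simp add: algebra_simps)
      ultimately show ?thesis
        unfolding t_def by (simp add: algebra_simps)
    qed
    moreover have "((\<lambda>k. t a b (k + 1) + (- (w * q ^ a)) * t a b k) has_sum
        (?P + (- (w * q ^ a)) * ?P)) UNIV"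
      using Suc.IH by (intro has_sum_add has_sum_cmult_right) (simp_all add: has_sum_int_shift)
    ultimately have "((\<lambda>k. t (Suc a) b (k + 1)) has_sum (?P + (- (w * q ^ a)) * ?P)) UNIV"
      by simp
    then have "(t (Suc a) b has_sum (?P + (- (w * q ^ a)) * ?P)) UNIV"
      by (simp add: has_sum_int_shift)
    also have "?P + (- (w * q ^ a)) * ?P =
        (\<Prod>j<Suc a. 1 - w * q ^ j) * (\<Prod>j<b. 1 - q ^ Suc j / w)"
      by (simp add: algebra_simps)
    finally show ?case .
  qed
  then show ?thesis
    by (simp add: t_def[abs_def])
qed

section \<open>Convergence of theta series and infinite products\<close>

lemma summable_theta_nat:
  fixes c r :: real
  assumes "0 \<le> c" "0 \<le> r" "r < 1"
  shows "summable (\<lambda>n. c ^ n * r ^ triangular (int n))"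
proof -
  \<comment> \<open>\<open>c * r ^ n\<close> is the ratio of consecutive terms; it tends to 0, so it
    is eventually at most 1/2.\<close>
  have "(\<lambda>n. c * r ^ n) \<longlonglongrightarrow> c * 0"
    using assms by (intro tendsto_mult tendsto_const LIMSEQ_realpow_zero) auto
  then have "eventually (\<lambda>n. c * r ^ n < 1 / 2) sequentially"
    by (rule order_tendstoD) auto
  then obtain N where N: "\<And>n. n \<ge> N \<Longrightarrow> c * r ^ n \<le> 1 / 2"
    using less_imp_le unfolding eventually_sequentially by blast
  show ?thesis
  proof (rule summable_ratio_test[where c = "1 / 2" and N = N])
    fix n assume "n \<ge> N"
    have "triangular (int (Suc n)) = triangular (int n) + n"
      using triangular_shift[of "int n"] by (simp add: add.commute)
    then have "c ^ Suc n * r ^ triangular (int (Suc n)) = (c * r ^ n) * (c ^ n * r ^ triangular (int n))"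
      by (simp add: power_add)
    also have "\<dots> \<le> 1 / 2 * (c ^ n * r ^ triangular (int n))"
      using assms N[OF \<open>n \<ge> N\<close>] by (intro mult_right_mono) auto
    finally show "norm (c ^ Suc n * r ^ triangular (int (Suc n))) \<le> 1 / 2 * norm (c ^ n * r ^ triangular (int n))"
      using assms by simp
  qed auto
qed

lemma summable_on_theta_int:
  fixes c r :: real
  assumes "0 < c" "0 \<le> r" "r < 1"
  shows "(\<lambda>k. c powi k * r ^ triangular k) summable_on UNIV"
proof -
  let ?f = "\<lambda>k. c powi k * r ^ triangular k"
  have "(?f \<circ> int) summable_on UNIV"
    using summable_theta_nat[of c r] assms by (intro norm_summable_imp_summable_on) (simp add: abs_mult)
  then have 1: "?f summable_on range int"
    by (subst summable_on_reindex) auto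
  have "(\<lambda>n. norm ((?f \<circ> (\<lambda>n. - int n)) n)) summable_on UNIV"
  proof (rule Infinite_Sum.abs_summable_on_comparison_test')
    show "(\<lambda>n. (1 / c) ^ n * r ^ triangular (int n)) summable_on UNIV"
      using summable_theta_nat[of "1 / c" r] assms by (intro norm_summable_imp_summable_on) (simp add: abs_mult)
    fix n :: nat
    \<comment> \<open>The two triangular numbers differ by \<open>n\<close>, so the negative
      half-line is dominated by the same series with \<open>1 / c\<close> in place of
      \<open>c\<close>.\<close>
    have "int (triangular (int n)) \<le> int (triangular (- int n))"
      using of_nat_triangular[of "int n"] of_nat_triangular[of "- int n"] by (simp add: algebra_simps)
    then have "r ^ triangular (- int n) \<le> r ^ triangular (int n)"
      using assms by (intro power_decreasing) auto
    then show "norm ((?f \<circ> (\<lambda>n. - int n)) n) \<le> (1 / c) ^ n * r ^ triangular (int n)"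
      using assms by (simp add: power_int_minus abs_mult field_simps)
  qed
  then have "(?f \<circ> (\<lambda>n. - int n)) summable_on UNIV"
    by (rule abs_summable_summable)
  then have 2: "?f summable_on range (\<lambda>n. - int n)"
    by (subst summable_on_reindex) (auto simp: inj_on_def)
  have "(UNIV :: int set) = range int \<union> range (\<lambda>n. - int n)"
    proof (intro equalityI subsetI)
    fix k :: int
    show "k \<in> range int \<union> range (\<lambda>n. - int n)"
      by (cases k rule: int_cases2) auto
  qed auto
  then show ?thesis
    using summable_on_union[OF 1 2] by simp
qed

text \<open>No condition on \<open>c\<close> is imposed: \<open>convergent_prod\<close> tolerates
  finitely many zero factors, which appear when \<open>c * q ^ j = 1\<close>.\<close>

lemma convergent_prod_geometric:
  fixes q c :: complex
  assumes "norm q < 1"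
  shows "convergent_prod (\<lambda>j. 1 - c * q ^ j)"
proof -
  have "summable (\<lambda>j. norm (- (c * q ^ j)))"
    using assms by (simp add: norm_mult norm_power summable_mult)
  then show ?thesis
    by (intro abs_convergent_prod_imp_convergent_prod)
      (simp add: abs_convergent_prod_conv_summable)
qed

lemma tendsto_prodinf_lessThan:
  fixes f :: "nat \<Rightarrow> 'a :: {real_normed_field}"
  assumes "convergent_prod f"
  shows "(\<lambda>n. \<Prod>i<n. f i) \<longlonglongrightarrow> prodinf f"
  using convergent_prod_LIMSEQ[OF assms] by (subst LIMSEQ_lessThan_iff_atMost)

lemma power_neq_1_of_norm_less_1:
  fixes q :: "'a :: real_normed_div_algebra"
  assumes "norm q < 1" "i > 0"
  shows "q ^ i \<noteq> 1"
proof -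
  have "norm (q ^ i) < 1"
    using assms by (cases "norm q = 0") (auto simp: norm_power power_less_one_iff)
  then show ?thesis by auto
qed

lemma filterlim_nat_add_int:
  "filterlim (\<lambda>n. nat (int n + k)) sequentially sequentially"
proof (rule filterlim_at_top_mono)
  show "filterlim (\<lambda>n. n - nat \<bar>k\<bar>) sequentially sequentially"
    by (rule filterlim_minus_const_nat_at_top)
  show "\<forall>\<^sub>F n in sequentially. n - nat \<bar>k\<bar> \<le> nat (int n + k)"
    by (rule always_eventually) (intro allI, linarith)
qed

theorem jacobi_triple_product:
  fixes q w :: complex
  assumes q: "norm q < 1" and w: "w \<noteq> 0"
  shows "((\<lambda>k. (-w) powi k * q ^ triangular k) has_sum
           (\<Prod>j. 1 - q ^ Suc j) * (\<Prod>j. 1 - w * q ^ j) * (\<Prod>j. 1 - q ^ Suc j / w)) UNIV"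
proof -
  note not_root = power_neq_1_of_norm_less_1[OF q]
  define E where "E = (\<Prod>j. 1 - q ^ Suc j)"
  define s where "s N = (\<Prod>j<N. 1 - w * q ^ j) * (\<Prod>j<N. 1 - q ^ Suc j / w)" for N
  define l where "l = (\<Prod>j. 1 - w * q ^ j) * (\<Prod>j. 1 - q ^ Suc j / w)"
  have cE: "convergent_prod (\<lambda>j. 1 - q ^ Suc j)"
    using convergent_prod_geometric[OF q, of q] by simp
  have qfact_lim: "qfact q \<longlonglongrightarrow> E"
    unfolding E_def qfact_def[abs_def] by (rule tendsto_prodinf_lessThan[OF cE])
  \<comment> \<open>A nonzero limit bounds both \<open>qfact q\<close> and its inverse, which gives
    one bound for all q-binomials.\<close>
  have E: "E \<noteq> 0"
    unfolding E_def by (rule prodinf_nonzero[OF cE]) (use not_root[of "Suc _"] in simp)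
  have "Bseq (qfact q)"
    using qfact_lim by (intro convergent_imp_Bseq convergentI)
  then obtain C where C: "C > 0" "\<And>n. norm (qfact q n) \<le> C"
    unfolding Bseq_def by blast
  have "(\<lambda>n. inverse (qfact q n)) \<longlonglongrightarrow> inverse E"
    by (intro tendsto_inverse qfact_lim E)
  then have "Bseq (\<lambda>n. inverse (qfact q n))"
    by (intro convergent_imp_Bseq convergentI)
  then obtain D where D: "D > 0" "\<And>n. norm (inverse (qfact q n)) \<le> D"
    unfolding Bseq_def by blast
  have qbinomial_bound: "norm (qbinomial q n k) \<le> C * (D * D)" for n k
  proof (cases "0 \<le> k \<and> k \<le> int n")
    case True
    have "norm (qbinomial q n k) = norm (qfact q n) *
        (norm (inverse (qfact q (nat k))) * norm (inverse (qfact q (nat (int n - k)))))"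
      using True by (simp add: qbinomial_def norm_mult norm_divide norm_inverse field_simps)
    also have "\<dots> \<le> C * (D * D)"
      using C D by (intro mult_mono) auto
    finally show ?thesis .
  qed (use C D in \<open>auto simp: qbinomial_def\<close>)
  have s_lim: "s \<longlonglongrightarrow> l"
    unfolding s_def l_def using convergent_prod_geometric[OF q, of w] convergent_prod_geometric[OF q, of "q / w"]
    by (intro tendsto_mult tendsto_prodinf_lessThan) simp_all
  have qbinomial_lim: "(\<lambda>N. qbinomial q (N + N) (int N + k)) \<longlonglongrightarrow> 1 / E" for k
  proof (rule Lim_transform_eventually)
    have "filterlim (\<lambda>N. nat (int N + k)) sequentially sequentially"
      "filterlim (\<lambda>N. nat (int N - k)) sequentially sequentially"
      "filterlim (\<lambda>N::nat. N + N) sequentially sequentially"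
      using filterlim_nat_add_int[of k] filterlim_nat_add_int[of "- k"]
        filterlim_subseq[of "\<lambda>N::nat. N + N"] by (simp_all add: strict_mono_def)
    then have "(\<lambda>N. qfact q (N + N) / (qfact q (nat (int N + k)) * qfact q (nat (int N - k)))) \<longlonglongrightarrow> E / (E * E)"
      using E by (intro tendsto_intros filterlim_compose[OF qfact_lim]) auto
    then show "(\<lambda>N. qfact q (N + N) / (qfact q (nat (int N + k)) * qfact q (nat (int N - k)))) \<longlonglongrightarrow> 1 / E"
      using E by simp
    show "\<forall>\<^sub>F N in sequentially. qfact q (N + N) / (qfact q (nat (int N + k)) * qfact q (nat (int N - k)))
       = qbinomial q (N + N) (int N + k)"
      using eventually_ge_at_top[of "nat \<bar>k\<bar>"]
      by eventually_elim (auto simp: qbinomial_def algebra_simps)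
  qed
  \<comment> \<open>Each coefficient tends to \<open>1 / E\<close>, so the limit is the triple
    product divided by \<open>E\<close>; multiplying by \<open>E\<close> afterwards supplies the
    third product.\<close>
  have "((\<lambda>k. (-w) powi k * q ^ triangular k * (1 / E)) has_sum l) UNIV"
  proof (rule tendsto_has_sum_dominated[OF _ _ _ _ s_lim])
    fix N
    show "((\<lambda>k. (-w) powi k * q ^ triangular k * qbinomial q (N + N) (int N + k)) has_sum s N) UNIV"
      unfolding s_def by (rule finite_jacobi_triple_product[OF not_root w])
  next
    fix k
    show "(\<lambda>N. (-w) powi k * q ^ triangular k * qbinomial q (N + N) (int N + k))
        \<longlonglongrightarrow> (-w) powi k * q ^ triangular k * (1 / E)"
      by (intro tendsto_mult tendsto_const qbinomial_lim)
  next
    fix N k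
    show "norm ((-w) powi k * q ^ triangular k * qbinomial q (N + N) (int N + k))
        \<le> (norm w powi k * norm q ^ triangular k) * (C * (D * D))"
      unfolding norm_mult norm_power norm_power_int norm_minus_cancel
      by (intro mult_left_mono qbinomial_bound) auto
  next
    show "(\<lambda>k. (norm w powi k * norm q ^ triangular k) * (C * (D * D))) summable_on UNIV"
      using q w by (intro summable_on_cmult_left summable_on_theta_int) auto
  qed
  from has_sum_cmult_right[OF this, of E] show ?thesis
    using E by (simp add: l_def E_def mult_ac)
qed

subsection \<open>Expansion of an infinite product over finite index sets\<close>

text \<open>Any finite family of finite sets lies in the power set of its union, where the sum
  factors into a product of terms \<open>1 + norm (f x)\<close>, bounded by the exponential of the
  sum of the norms.\<close>

lemma summable_on_prod_Fpow:
  fixes f :: "'a \<Rightarrow> 'b :: real_normed_field"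
  assumes "(\<lambda>x. norm (f x)) summable_on M"
  shows "(\<lambda>F. norm (prod f F)) summable_on Fpow M"
proof (rule nonneg_bdd_above_summable_on)
  show "bdd_above (sum (\<lambda>F. norm (prod f F)) ` {\<F>. \<F> \<subseteq> Fpow M \<and> finite \<F>})"
  proof (rule bdd_aboveI2)
    fix \<F> assume "\<F> \<in> {\<F>. \<F> \<subseteq> Fpow M \<and> finite \<F>}"
    then have "finite (\<Union>\<F>)" "\<Union>\<F> \<subseteq> M"
      by (auto simp: Fpow_def)
    have "(\<Sum>F\<in>\<F>. norm (prod f F)) \<le> (\<Sum>F\<in>Pow (\<Union>\<F>). norm (prod f F))"
      using \<open>finite (\<Union>\<F>)\<close> by (intro sum_mono2) auto
    also have "\<dots> = (\<Prod>x\<in>\<Union>\<F>. norm (f x) + 1)"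
      using \<open>finite (\<Union>\<F>)\<close> by (simp add: prod_add prod_norm)
    also have "\<dots> \<le> exp (\<Sum>x\<in>\<Union>\<F>. norm (f x))"
      using prod_le_exp_sum[of "\<Union>\<F>" "\<lambda>x. norm (f x)"] by (simp add: add.commute)
    also have "\<dots> \<le> exp (\<Sum>\<^sub>\<infinity>x\<in>M. norm (f x))"
      using assms \<open>finite (\<Union>\<F>)\<close> \<open>\<Union>\<F> \<subseteq> M\<close> by (simp add: finite_sum_le_infsum)
    finally show "(\<Sum>F\<in>\<F>. norm (prod f F)) \<le> exp (\<Sum>\<^sub>\<infinity>x\<in>M. norm (f x))" .
  qed
qed auto

text \<open>Summing over \<open>Pow (X N)\<close> gives the finite product of
  \<open>1 + f x\<close>, and these power sets eventually contain every finite family in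
  \<open>Fpow M\<close>. Leaving \<open>X\<close> free lets the product be evaluated along a
  convenient exhaustion.\<close>

lemma has_sum_prod_Fpow:
  fixes f :: "'a \<Rightarrow> 'b :: {real_normed_field, banach}"
  assumes f: "(\<lambda>x. norm (f x)) summable_on M"
    and X: "\<And>N. finite (X N)" "incseq X" "(\<Union>N. X N) = M"
    and lim: "(\<lambda>N. \<Prod>x\<in>X N. 1 + f x) \<longlonglongrightarrow> P"
  shows "(prod f has_sum P) (Fpow M)"
proof -
  have "prod f summable_on Fpow M"
    using summable_on_prod_Fpow[OF f] by (rule abs_summable_summable)
  then have hs: "(prod f has_sum infsum (prod f) (Fpow M)) (Fpow M)"
    by simp
  have "filterlim (\<lambda>N. Pow (X N)) (finite_subsets_at_top (Fpow M)) sequentially"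
    unfolding filterlim_iff eventually_finite_subsets_at_top
  proof safe
    fix P' and \<F> :: "'a set set"
    assume \<F>: "finite \<F>" "\<F> \<subseteq> Fpow M"
      and P': "\<forall>Y. finite Y \<and> \<F> \<subseteq> Y \<and> Y \<subseteq> Fpow M \<longrightarrow> P' Y"
    have "finite (\<Union>\<F>)"
      using \<F> by (auto simp: Fpow_def)
    moreover have "\<forall>x\<in>\<Union>\<F>. \<forall>\<^sub>F N in sequentially. x \<in> X N"
    proof
      fix x assume "x \<in> \<Union>\<F>"
      then have "x \<in> M"
        using \<F> by (auto simp: Fpow_def)
      then obtain N where "x \<in> X N"
        using X(3) by blast
      then show "\<forall>\<^sub>F N in sequentially. x \<in> X N"
        using X(2) unfolding eventually_sequentially incseq_def by blast
    qed
    ultimately have "\<forall>\<^sub>F N in sequentially. \<forall>x\<in>\<Union>\<F>. x \<in> X N"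
      by (rule eventually_ball_finite)
    then show "\<forall>\<^sub>F N in sequentially. P' (Pow (X N))"
    proof eventually_elim
      case (elim N)
      have "X N \<subseteq> M"
        using X(3) by blast
      then have "Pow (X N) \<subseteq> Fpow M"
        using finite_subset[OF _ X(1)] by (auto simp: Fpow_def)
      then show ?case
        using P' elim X(1)[of N] by blast
    qed
  qed
  with hs have "(\<lambda>N. \<Sum>F\<in>Pow (X N). prod f F) \<longlonglongrightarrow> infsum (prod f) (Fpow M)"
    unfolding has_sum_def by (rule filterlim_compose)
  moreover have "(\<Sum>F\<in>Pow (X N). prod f F) = (\<Prod>x\<in>X N. 1 + f x)" for N
    using prod_add[OF X(1)[of N], of f "\<lambda>_. 1"] by (simp add: add.commute)
  ultimately have "P = infsum (prod f) (Fpow M)"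
    using lim LIMSEQ_unique by simp
  with hs show ?thesis by simp
qed

text \<open>A strictly increasing list is determined by its set of entries, so the index tuples may
  be replaced by sets of cardinality \<open>k\<close>.\<close>

lemma A_series_conv_Fpow:
  "A_series S n k q =
     (\<Sum>\<^sub>\<infinity>F\<in>{F \<in> Fpow {m. 0 < m \<and> mem_mod m S n}. card F = k}. \<Prod>m\<in>F. q ^ m / (1 - q ^ m)\<^sup>2)"
  unfolding A_series_def
proof (rule infsum_reindex_bij_witness[of _ sorted_list_of_set set])
  fix ms assume "ms \<in> index_tuples S n k"
  then have ms: "length ms = k" "sorted_wrt (<) ms" "\<forall>m\<in>set ms. 0 < m \<and> mem_mod m S n"
    by (auto simp: index_tuples_def)
  then have d: "distinct ms" "sorted ms"
    by (simp_all add: strict_sorted_iff)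
  then show "sorted_list_of_set (set ms) = ms"
    by (simp add: sorted_list_of_set.idem_if_sorted_distinct)
  show "set ms \<in> {F \<in> Fpow {m. 0 < m \<and> mem_mod m S n}. card F = k}"
    using ms d by (auto simp: Fpow_def distinct_card)
  have "(\<Prod>m\<in>set ms. q ^ m / (1 - q ^ m)\<^sup>2) = prod_list (map (\<lambda>m. q ^ m / (1 - q ^ m)\<^sup>2) ms)"
    using d by (simp add: prod.distinct_set_conv_list)
  also have "\<dots> = q ^ sum_list ms / prod_list (map (\<lambda>m. (1 - q ^ m)\<^sup>2) ms)"
    by (induction ms) (simp_all add: power_add)
  finally show "(\<Prod>m\<in>set ms. q ^ m / (1 - q ^ m)\<^sup>2) = q ^ sum_list ms / prod_list (map (\<lambda>m. (1 - q ^ m)\<^sup>2) ms)" .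
next
  fix F assume "F \<in> {F \<in> Fpow {m. 0 < m \<and> mem_mod m S n}. card F = k}"
  then show "set (sorted_list_of_set F) = F" "sorted_list_of_set F \<in> index_tuples S n k"
    by (auto simp: Fpow_def index_tuples_def)
qed

subsection \<open>Products over residue classes and theta functions\<close>

text \<open>The starting exponent is deliberately not reduced mod \<open>n\<close>: starts 0 and
  \<open>n\<close> differ by the factor \<open>1 - z\<close>, which is what distinguishes the class
  \<open>l = n\<close>.\<close>

definition arith_prod :: "complex \<Rightarrow> nat \<Rightarrow> nat \<Rightarrow> complex \<Rightarrow> complex" where
  "arith_prod q n l z = (\<Prod>j. 1 - z * q ^ (l + n * j))"

context
  fixes n :: nat and q :: complex
  assumes n: "n > 0" and q: "norm q < 1"
begin

lemma norm_q_power: "norm (q ^ n) < 1"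
  using q n by (simp add: norm_power power_less_one_iff)

lemma convergent_arith_prod: "convergent_prod (\<lambda>j. 1 - z * q ^ (l + n * j))"
  using convergent_prod_geometric[OF norm_q_power, of "z * q ^ l"]
  by (simp add: power_add power_mult mult.assoc)

lemma tendsto_arith_prod: "(\<lambda>N. \<Prod>j<N. 1 - z * q ^ (l + n * j)) \<longlonglongrightarrow> arith_prod q n l z"
  unfolding arith_prod_def by (rule tendsto_prodinf_lessThan[OF convergent_arith_prod])

lemma arith_prod_1_nonzero:
  assumes "l > 0"
  shows "arith_prod q n l 1 \<noteq> 0"
  unfolding arith_prod_def
  using power_neq_1_of_norm_less_1[OF q, of "l + n * _"] assms
  by (intro prodinf_nonzero convergent_arith_prod) auto

lemma arith_prod_0: "arith_prod q n 0 z = (1 - z) * arith_prod q n n z"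
proof (rule LIMSEQ_unique)
  show "(\<lambda>N. \<Prod>j<Suc N. 1 - z * q ^ (0 + n * j)) \<longlonglongrightarrow> arith_prod q n 0 z"
    by (rule LIMSEQ_Suc[OF tendsto_arith_prod])
  have "(\<lambda>N. (1 - z) * (\<Prod>j<N. 1 - z * q ^ (n + n * j))) \<longlonglongrightarrow> (1 - z) * arith_prod q n n z"
    by (intro tendsto_mult tendsto_const tendsto_arith_prod)
  then show "(\<lambda>N. \<Prod>j<Suc N. 1 - z * q ^ (0 + n * j)) \<longlonglongrightarrow> (1 - z) * arith_prod q n n z"
    by (simp add: prod.lessThan_Suc_shift del: prod.lessThan_Suc)
qed

lemma A_series_generating_function:
  assumes S: "S \<subseteq> {1..n}" and z: "z \<noteq> 0" and y: "y = z + 1 / z - 2"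
  shows "(\<lambda>k. (-1) ^ k * A_series S n k q * y ^ k) sums
    (\<Prod>l\<in>S. arith_prod q n l z * arith_prod q n l (1 / z) / arith_prod q n l 1 ^ 2)"
proof -
  define a where "a m = q ^ m / (1 - q ^ m)\<^sup>2" for m
  define M where "M = {m. 0 < m \<and> mem_mod m S n}"
  \<comment> \<open>On these rectangles the product over \<open>m\<close> splits into one partial
    \<open>arith_prod\<close> per class.\<close>
  define X where "X N = (\<lambda>(l, j). l + n * j) ` (S \<times> {..<N})" for N
  define P where "P = (\<Prod>l\<in>S. arith_prod q n l z * arith_prod q n l (1 / z) / arith_prod q n l 1 ^ 2)"
  note not_root = power_neq_1_of_norm_less_1[OF q]
  have "finite S"
    using S finite_subset by blast

  have sum_a: "(\<lambda>m. norm (a m)) summable_on M"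
  \<comment> \<open>For \<open>m > 0\<close> the denominator stays away from 0, since
    \<open>norm (1 - q ^ m)\<close> is at least \<open>1 - norm q\<close>; a geometric series
    dominates.\<close>
  proof (rule Infinite_Sum.abs_summable_on_comparison_test')
    have "(\<lambda>m. norm q ^ m / (1 - norm q)\<^sup>2) summable_on UNIV"
      using q by (intro norm_summable_imp_summable_on) (simp add: summable_divide)
    then show "(\<lambda>m. norm q ^ m / (1 - norm q)\<^sup>2) summable_on M"
      by (rule summable_on_subset) auto
    fix m assume "m \<in> M"
    then have "norm q ^ m \<le> norm q ^ 1"
      using q by (intro power_decreasing) (auto simp: M_def)
    moreover have "1 - norm (q ^ m) \<le> norm (1 - q ^ m)"
      using norm_triangle_ineq2[of 1 "q ^ m"] by simp
    ultimately have *: "1 - norm q \<le> norm (1 - q ^ m)"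
      by (simp add: norm_power)
    then have "0 < norm (1 - q ^ m)"
      using q by linarith
    moreover have "(1 - norm q)\<^sup>2 \<le> norm (1 - q ^ m) ^ 2"
      using * q by (intro power_mono) auto
    ultimately show "norm (a m) \<le> norm q ^ m / (1 - norm q)\<^sup>2"
      using q unfolding a_def norm_divide norm_power by (intro divide_left_mono) auto
  qed

  have inj: "inj_on (\<lambda>(l, j). l + n * j) (S \<times> {..<N})" for N
  proof (rule inj_onI, clarsimp)
    fix l j l' j' assume l: "l \<in> S" "l' \<in> S" and eq: "l + n * j = l' + n * j'"
    have l1: "1 \<le> l" "l \<le> n" "1 \<le> l'" "l' \<le> n"
      using S l by auto
    have div: "(r + n * i) div n = i" if "r < n" for r i :: nat
      using that by simp
    \<comment> \<open>Representatives run over 1 to \<open>n\<close>, so \<open>l - 1\<close> rather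
      than \<open>l\<close> is a remainder for division by \<open>n\<close>.\<close>
    have "(l - 1) + n * j = (l' - 1) + n * j'"
      using eq l1 by simp
    moreover have "l - 1 < n" "l' - 1 < n"
      using l1 n by auto
    ultimately have "j = j'"
      using div by metis
    with eq show "l = l' \<and> j = j'" by simp
  qed
  have UN_X: "(\<Union>N. X N) = M"
  proof (intro equalityI subsetI)
    fix m assume "m \<in> (\<Union>N. X N)"
    then obtain l j where "l \<in> S" "m = l + n * j"
      by (auto simp: X_def)
    then show "m \<in> M"
      using S by (auto simp: M_def mem_mod_def cong_def intro!: bexI[of _ l])
  next
    fix m assume "m \<in> M"
    then obtain l where l: "l \<in> S" "[m = l] (mod n)" "0 < m"
      by (auto simp: M_def mem_mod_def)
    have "l \<le> m"
    proof (rule ccontr)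
      assume "\<not> l \<le> m"
      moreover have "1 \<le> l" "l \<le> n" using S l by auto
      ultimately have "n dvd l - m" "0 < l - m" "l - m < n"
        using l cong_altdef_nat[of m l n] cong_sym[of m l n] by (auto simp: cong_altdef_nat)
      then show False
        using nat_dvd_not_less by blast
    qed
    then obtain j where "m = l + n * j"
      using l(2) by (metis cong_altdef_nat dvdE le_add_diff_inverse)
    then have "m \<in> X (Suc j)"
      using l(1) by (auto simp: X_def intro!: image_eqI[of _ _ "(l, j)"])
    then show "m \<in> (\<Union>N. X N)" by blast
  qed

  have factor: "1 + - y * a m = (1 - z * q ^ m) * (1 - 1 / z * q ^ m) / (1 - 1 * q ^ m) ^ 2"
    if "m > 0" for m
  proof -
    have "1 - q ^ m \<noteq> 0"
      using not_root[OF that] by simp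
    then show ?thesis
      using z unfolding a_def y by (simp add: divide_simps) (simp add: power2_eq_square algebra_simps)
  qed
  have "(prod (\<lambda>m. - y * a m) has_sum P) (Fpow M)"
  proof (rule has_sum_prod_Fpow[where X = X])
    show "(\<lambda>m. norm (- y * a m)) summable_on M"
      unfolding norm_mult by (intro summable_on_cmult_right sum_a)
    show "finite (X N)" for N
      using \<open>finite S\<close> by (simp add: X_def)
    show "incseq X"
      unfolding incseq_def X_def by (auto intro!: image_mono)
    show "(\<Union>N. X N) = M" by fact
    have "(\<Prod>m\<in>X N. 1 + - y * a m) = (\<Prod>l\<in>S. (\<Prod>j<N. 1 - z * q ^ (l + n * j))
        * (\<Prod>j<N. 1 - 1 / z * q ^ (l + n * j)) / (\<Prod>j<N. 1 - 1 * q ^ (l + n * j)) ^ 2)" for N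
    proof -
      have "(\<Prod>m\<in>X N. 1 + - y * a m) = (\<Prod>(l, j)\<in>S \<times> {..<N}. 1 + - y * a (l + n * j))"
        unfolding X_def by (subst prod.reindex[OF inj]) (simp add: case_prod_unfold)
      also have "\<dots> = (\<Prod>l\<in>S. \<Prod>j<N. 1 + - y * a (l + n * j))"
        by (simp add: prod.cartesian_product)
      also have "\<dots> = (\<Prod>l\<in>S. \<Prod>j<N. (1 - z * q ^ (l + n * j)) * (1 - 1 / z * q ^ (l + n * j))
          / (1 - 1 * q ^ (l + n * j)) ^ 2)"
        using S by (intro prod.cong refl factor) auto
      finally show ?thesis
        by (simp only: prod.distrib prod_dividef prod_power_distrib)
    qed
    moreover have "(\<lambda>N. \<Prod>j<N. 1 - q ^ (l + n * j)) \<longlonglongrightarrow> arith_prod q n l 1" for l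
      using tendsto_arith_prod[of 1 l] by simp
    ultimately show "(\<lambda>N. \<Prod>m\<in>X N. 1 + - y * a m) \<longlonglongrightarrow> P"
      unfolding P_def using S arith_prod_1_nonzero
      by (auto intro!: tendsto_prod tendsto_divide tendsto_mult tendsto_power tendsto_arith_prod
          simp del: mult_1 times_divide_eq_left)
  qed
  \<comment> \<open>Tagging each set with its cardinality turns the sum over \<open>Fpow M\<close>
    into an iterated sum with outer index \<open>k\<close>.\<close>
  moreover have "((\<lambda>(k, F). \<Prod>m\<in>F. - y * a m) has_sum P) (SIGMA k:UNIV. {F \<in> Fpow M. card F = k})
      \<longleftrightarrow> (prod (\<lambda>m. - y * a m) has_sum P) (Fpow M)"
    by (rule has_sum_reindex_bij_witness[of _ "\<lambda>F. (card F, F)" snd]) auto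
  ultimately have "((\<lambda>(k, F). \<Prod>m\<in>F. - y * a m) has_sum P) (SIGMA k:UNIV. {F \<in> Fpow M. card F = k})"
    by blast
  then have "((\<lambda>k. (-1) ^ k * A_series S n k q * y ^ k) has_sum P) UNIV"
  proof (rule has_sum_Sigma')
    fix k :: nat
    \<comment> \<open>Summability ensures that the \<open>infsum\<close> in \<open>A_series\<close>
      is a true sum and not the default value 0.\<close>
    have "prod a summable_on Fpow M"
      using summable_on_prod_Fpow[OF sum_a] by (rule abs_summable_summable)
    then have "prod a summable_on {F \<in> Fpow M. card F = k}"
      by (rule summable_on_subset) auto
    then have "(prod a has_sum A_series S n k q) {F \<in> Fpow M. card F = k}"
      unfolding A_series_conv_Fpow a_def M_def by simp
    then have "((\<lambda>F. (- y) ^ k * prod a F) has_sum ((- y) ^ k * A_series S n k q)) {F \<in> Fpow M. card F = k}"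
      by (rule has_sum_cmult_right)
    also have "?this \<longleftrightarrow> ((\<lambda>F. \<Prod>m\<in>F. - y * a m) has_sum ((- y) ^ k * A_series S n k q))
        {F \<in> Fpow M. card F = k}"
      by (rule has_sum_cong) (auto simp only: prod.distrib prod_constant)
    also have "(- y) ^ k * A_series S n k q = (-1) ^ k * A_series S n k q * y ^ k"
      by (subst power_minus) (simp only: mult_ac)
    finally show "((\<lambda>F. case (k, F) of (k, F) \<Rightarrow> \<Prod>m\<in>F. - y * a m)
        has_sum ((-1) ^ k * A_series S n k q * y ^ k)) {F \<in> Fpow M. card F = k}"
      by simp
  qed
  then show ?thesis
    unfolding P_def by (rule has_sum_imp_sums)
qed

end

text \<open>With \<open>r = alpha n l\<close> one has \<open>n * r = l - n / 2\<close>, so \<open>n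
  * (k + r)^2 / 2 = n * r^2 / 2 + l * k + n * k * (k - 1) / 2\<close>. The part free of
  \<open>k\<close> is the prefactor; the rest is the triple product in base \<open>q ^ n\<close>
  with \<open>w = z * q ^ l\<close>.\<close>

lemma vartheta_neg_product:
  fixes \<tau> \<sigma> q z :: complex
  assumes n: "n > 0" and l: "l \<le> n"
    and q_eq: "q = exp (2 * pi * \<i> * \<tau>)" and q: "norm q < 1" and z_eq: "z = exp (2 * pi * \<i> * \<sigma>)"
  shows "vartheta_neg (alpha n l) (of_nat n * \<tau>) \<sigma> =
    exp (pi * \<i> * of_rat (alpha n l)) * exp (pi * \<i> * of_nat n * \<tau> * of_rat (alpha n l) ^ 2)
      * exp (2 * pi * \<i> * of_rat (alpha n l) * \<sigma>)
      * (arith_prod q n n 1 * arith_prod q n l z * arith_prod q n (n - l) (1 / z))"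
proof -
  define r where "r = alpha n l"
  define \<rho> :: complex where "\<rho> = of_rat r"
  define w where "w = z * q ^ l"
  define c where "c = exp (pi * \<i> * \<rho>) * exp (pi * \<i> * of_nat n * \<tau> * \<rho> ^ 2) * exp (2 * pi * \<i> * \<rho> * \<sigma>)"
  define L where "L = arith_prod q n n 1 * arith_prod q n l z * arith_prod q n (n - l) (1 / z)"
  have nz: "q \<noteq> 0" "z \<noteq> 0" "w \<noteq> 0"
    by (auto simp: q_eq z_eq w_def)
  have \<rho>: "of_nat n * \<rho> = of_nat l - of_nat n / 2"
    using n by (simp add: \<rho>_def r_def alpha_def of_rat_diff of_rat_divide right_diff_distrib)
  have "((\<lambda>k. (-w) powi k * (q ^ n) ^ triangular k) has_sum
      (\<Prod>j. 1 - (q ^ n) ^ Suc j) * (\<Prod>j. 1 - w * (q ^ n) ^ j) * (\<Prod>j. 1 - (q ^ n) ^ Suc j / w)) UNIV"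
    using nz norm_q_power[OF n q] by (intro jacobi_triple_product)
  also have "(\<Prod>j. 1 - (q ^ n) ^ Suc j) = arith_prod q n n 1"
    by (simp add: arith_prod_def power_add power_mult)
  also have "(\<Prod>j. 1 - w * (q ^ n) ^ j) = arith_prod q n l z"
    by (simp add: arith_prod_def w_def power_add power_mult mult.assoc)
  also have "(q ^ n) ^ Suc j / w = 1 / z * q ^ (n - l + n * j)" for j
    using nz l by (simp add: w_def field_simps flip: power_add power_mult)
  then have "(\<Prod>j. 1 - (q ^ n) ^ Suc j / w) = arith_prod q n (n - l) (1 / z)"
    by (simp add: arith_prod_def)
  finally have "((\<lambda>k. c * ((-w) powi k * (q ^ n) ^ triangular k)) has_sum c * L) UNIV"
    unfolding L_def by (rule has_sum_cmult_right)
  moreover have "c * ((-w) powi k * (q ^ n) ^ triangular k) =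
      exp (pi * \<i> * of_rat (of_int k + r)) * exp (2 * pi * \<i> * (of_nat n * \<tau>) * of_rat ((of_int k + r)\<^sup>2 / 2))
        * exp (2 * pi * \<i> * of_rat (of_int k + r) * \<sigma>)" for k
  proof -
    \<comment> \<open>Writing -1 as \<open>exp (pi * \<i>)\<close> matches the convention in
      \<open>vartheta_neg\<close>; the exponents then agree exactly, not merely modulo
      \<open>2 * pi * \<i>\<close>.\<close>
    have "- w = exp (pi * \<i> + 2 * pi * \<i> * \<sigma> + of_nat l * (2 * pi * \<i> * \<tau>))"
      unfolding exp_add exp_of_nat_mult by (simp add: w_def z_eq q_eq)
    then have 1: "(- w) powi k = exp (of_int k * (pi * \<i> + 2 * pi * \<i> * \<sigma> + of_nat l * (2 * pi * \<i> * \<tau>)))"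
      by (simp only: exp_power_int)
    have "of_int (2 * int (triangular k)) = (of_int (k * (k - 1)) :: complex)"
      by (simp only: of_nat_triangular)
    then have t: "of_nat (triangular k) = (of_int k * (of_int k - 1) / 2 :: complex)"
      by (simp add: field_simps)
    have 2: "(q ^ n) ^ triangular k = exp (of_nat (triangular k) * (of_nat n * (2 * pi * \<i> * \<tau>)))"
      by (simp only: exp_of_nat_mult q_eq)
    have l': "of_nat l = of_nat n * \<rho> + of_nat n / 2"
      using \<rho> by simp
    show ?thesis
      unfolding c_def 1 2 t l' of_rat_add of_rat_divide of_rat_power of_rat_of_int_eq \<rho>_def[symmetric]
        exp_add[symmetric] of_rat_numeral_eq
      by (rule arg_cong[where f = exp]) (simp add: field_simps power2_eq_square)
  qed
  ultimately have "((\<lambda>k::int. exp (pi * \<i> * of_rat (of_int k + r)) * exp (2 * pi * \<i> * (of_nat n * \<tau>) * of_rat ((of_int k + r)\<^sup>2 / 2))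
        * exp (2 * pi * \<i> * of_rat (of_int k + r) * \<sigma>)) has_sum c * L) UNIV"
    by simp
  moreover have "(\<lambda>k. k + r) ` \<int> = (\<lambda>k::int. of_int k + r) ` UNIV"
    by (auto simp: Ints_def)
  ultimately have "vartheta_neg r (of_nat n * \<tau>) \<sigma> = c * L"
    unfolding vartheta_neg_def by (simp add: infsum_reindex inj_on_def o_def infsumI)
  then show ?thesis
    by (simp add: r_def c_def L_def \<rho>_def)
qed

section \<open>Symmetry of the residue classes and quotients of theta functions\<close>

lemma symmetric_reps_diff:
  assumes "symmetric_reps n S" "l \<in> S" "l \<noteq> n"
  shows "n - l \<in> S"
proof -
  obtain l' where l': "l' \<in> S" "[int l' = - int l] (mod int n)"
    using assms by (auto simp: symmetric_reps_def)
  have range: "1 \<le> l'" "l' \<le> n" "1 \<le> l" "l < n"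
    using assms l'(1) by (auto simp: symmetric_reps_def)
  have "int n dvd int (l' + l)"
    using l'(2) by (simp add: cong_iff_dvd_diff)
  then obtain k where k: "l' + l = n * k"
    by (auto simp only: int_dvd_int_iff)
  \<comment> \<open>The sum \<open>l' + l\<close> is a multiple of \<open>n\<close> strictly between
    0 and \<open>2 * n\<close>.\<close>
  have "n * 0 < n * k" "n * k < n * 2"
    using range by (simp_all flip: k)
  then have "k = 1"
    unfolding mult_less_cancel1 by linarith
  with k have "l' = n - l" by simp
  with l'(1) show ?thesis by simp
qed

lemma alpha_diff: "n > 0 \<Longrightarrow> l \<le> n \<Longrightarrow> alpha n (n - l) = - alpha n l"
  by (simp add: alpha_def of_nat_diff diff_divide_distrib)

text \<open>In each quotient the prefactors in \<open>\<tau>\<close> and the product over multiples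
  of \<open>n\<close> cancel. The involution \<open>l\<close> to \<open>n - l\<close> handles the
  rest: it negates \<open>alpha\<close>, killing the powers of \<open>z\<close>, and realigns the
  factors in \<open>1 / z\<close>. As \<open>n\<close> is excluded, \<open>n - l\<close> stays
  positive and the denominators are nonzero.\<close>

lemma prod_vartheta_ratio:
  fixes \<tau> \<sigma> q z :: complex
  assumes n: "n > 0" and S: "symmetric_reps n S" "n \<notin> S"
    and q_eq: "q = exp (2 * pi * \<i> * \<tau>)" and q: "norm q < 1" and z_eq: "z = exp (2 * pi * \<i> * \<sigma>)"
  shows "(\<Prod>l\<in>S. vartheta_neg (alpha n l) (of_nat n * \<tau>) \<sigma> / vartheta_null (alpha n l) (of_nat n * \<tau>)) =
    (\<Prod>l\<in>S. arith_prod q n l z * arith_prod q n l (1 / z) / arith_prod q n l 1 ^ 2)"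
proof -
  let ?C = "arith_prod q n"
  have "S \<subseteq> {1..n}"
    using S(1) by (simp add: symmetric_reps_def)
  then have lS: "1 \<le> l" "l < n" if "l \<in> S" for l
    using S(2) that by (auto simp: less_le)
  have refl_S: "n - l \<in> S" if "l \<in> S" for l
    using symmetric_reps_diff S that by metis
  have bij: "bij_betw (\<lambda>l. n - l) S S"
    by (rule bij_betwI[where g = "\<lambda>l. n - l"]) (use refl_S lS in \<open>auto simp: less_imp_le\<close>)
  have "(\<Sum>l\<in>S. alpha n l) = (\<Sum>l\<in>S. alpha n (n - l))"
    by (rule sum.reindex_bij_betw[OF bij, symmetric])
  also have "\<dots> = - (\<Sum>l\<in>S. alpha n l)"
    using lS n by (simp add: alpha_diff less_imp_le flip: sum_negf)
  finally have "(\<Sum>l\<in>S. alpha n l) = 0" by simp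
  then have "(\<Sum>l\<in>S. of_rat (alpha n l)) = (0 :: complex)"
    by (simp flip: of_rat_sum)
  then have exps: "(\<Prod>l\<in>S. exp (2 * pi * \<i> * of_rat (alpha n l) * \<sigma>)) = 1"
    using S(1) finite_subset[of S "{1..n}"]
    by (simp add: symmetric_reps_def exp_sum[symmetric] sum_distrib_right[symmetric]
        sum_distrib_left[symmetric])
  have "(\<Prod>l\<in>S. vartheta_neg (alpha n l) (of_nat n * \<tau>) \<sigma> / vartheta_null (alpha n l) (of_nat n * \<tau>)) =
      (\<Prod>l\<in>S. exp (2 * pi * \<i> * of_rat (alpha n l) * \<sigma>) *
        (?C l z / ?C l 1 * (?C (n - l) (1 / z) / ?C (n - l) 1)))"
  proof (rule prod.cong[OF refl])
    fix l assume "l \<in> S"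
    note l = lS[OF this]
    have "vartheta_null (alpha n l) (of_nat n * \<tau>) =
        exp (pi * \<i> * of_rat (alpha n l)) * exp (pi * \<i> * of_nat n * \<tau> * of_rat (alpha n l) ^ 2)
          * (?C n 1 * ?C l 1 * ?C (n - l) 1)"
      unfolding vartheta_null_def
      using vartheta_neg_product[OF n _ q_eq q, of l 1 0] l by simp
    moreover have "?C l 1 \<noteq> 0" "?C (n - l) 1 \<noteq> 0" "?C n 1 \<noteq> 0"
      using l n by (auto intro!: arith_prod_1_nonzero[OF n q])
    ultimately show "vartheta_neg (alpha n l) (of_nat n * \<tau>) \<sigma> / vartheta_null (alpha n l) (of_nat n * \<tau>)
      = exp (2 * pi * \<i> * of_rat (alpha n l) * \<sigma>) * (?C l z / ?C l 1 * (?C (n - l) (1 / z) / ?C (n - l) 1))"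
      using vartheta_neg_product[OF n _ q_eq q z_eq, of l] l by simp
  qed
  also have "\<dots> = (\<Prod>l\<in>S. ?C l z / ?C l 1) * (\<Prod>l\<in>S. ?C (n - l) (1 / z) / ?C (n - l) 1)"
    by (simp only: prod.distrib exps mult_1)
  also have "(\<Prod>l\<in>S. ?C (n - l) (1 / z) / ?C (n - l) 1) = (\<Prod>l\<in>S. ?C l (1 / z) / ?C l 1)"
    by (rule prod.reindex_bij_betw[OF bij])
  finally show ?thesis
    by (simp add: power2_eq_square flip: prod.distrib)
qed

text \<open>Here \<open>alpha\<close> is 1/2, so the prefactor is
  \<open>\<i> * e * exp (pi * \<i> * \<sigma>)\<close>, where \<open>e\<close> is also the cube of
  the exponential factor of \<open>dedekind_eta\<close>. The last product starts at exponent 0 and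
  yields \<open>1 - 1 / z\<close>, which the half power of \<open>z\<close> turns into the
  difference on the right.\<close>

lemma vartheta_neg_div_dedekind_eta:
  fixes \<tau> \<sigma> q z :: complex
  assumes n: "n > 0"
    and q_eq: "q = exp (2 * pi * \<i> * \<tau>)" and q: "norm q < 1" and z_eq: "z = exp (2 * pi * \<i> * \<sigma>)"
  shows "- \<i> * (vartheta_neg (alpha n n) (of_nat n * \<tau>) \<sigma> / dedekind_eta (of_nat n * \<tau>) ^ 3) =
    (exp (pi * \<i> * \<sigma>) - exp (- (pi * \<i> * \<sigma>)))
      * (arith_prod q n n z * arith_prod q n n (1 / z) / arith_prod q n n 1 ^ 2)"
proof -
  let ?C = "arith_prod q n"
  define e where "e = exp (pi * \<i> * of_nat n * \<tau> / 4)"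
  have alpha: "of_rat (alpha n n) = (1 / 2 :: complex)"
    using n by (simp add: alpha_def of_rat_divide)
  have exp_half_pi: "exp (pi * \<i> / 2) = \<i>"
    using exp_Euler[of "pi / 2"] by (simp add: mult_ac sin_of_real cos_of_real)
  have C1: "?C n 1 \<noteq> 0"
    by (rule arith_prod_1_nonzero[OF n q n])
  have "exp (2 * pi * \<i> * (of_nat n * \<tau>)) = q ^ n"
    by (simp add: q_eq mult_ac flip: exp_of_nat_mult)
  then have "(\<Prod>m. 1 - exp (2 * pi * \<i> * (of_nat n * \<tau>)) ^ Suc m) = ?C n 1"
    by (simp add: arith_prod_def power_add power_mult)
  then have "dedekind_eta (of_nat n * \<tau>) ^ 3 = exp (2 * pi * \<i> * (of_nat n * \<tau>) / 24) ^ 3 * ?C n 1 ^ 3"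
    by (simp add: dedekind_eta_def power_mult_distrib)
  also have "exp (2 * pi * \<i> * (of_nat n * \<tau>) / 24) ^ 3 = e"
    by (simp add: e_def mult_ac flip: exp_of_nat_mult)
  finally have eta: "dedekind_eta (of_nat n * \<tau>) ^ 3 = e * ?C n 1 ^ 3" .
  have half: "exp (pi * \<i> * \<sigma>) * (1 - 1 / z) = exp (pi * \<i> * \<sigma>) - exp (- (pi * \<i> * \<sigma>))"
    by (simp add: z_eq right_diff_distrib exp_minus flip: exp_diff) (simp add: field_simps flip: exp_add)
  have "vartheta_neg (alpha n n) (of_nat n * \<tau>) \<sigma> =
      \<i> * e * exp (pi * \<i> * \<sigma>) * (?C n 1 * ?C n z * ((1 - 1 / z) * ?C n (1 / z)))"
    using vartheta_neg_product[OF n order_refl q_eq q z_eq]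
    by (simp add: alpha arith_prod_0[OF n q] e_def exp_half_pi power_divide)
  also have "\<dots> = \<i> * e * (exp (pi * \<i> * \<sigma>) * (1 - 1 / z)) * (?C n 1 * ?C n z * ?C n (1 / z))"
    by (simp only: mult_ac)
  finally show ?thesis
    unfolding eta half using C1 by (simp add: e_def power2_eq_square power3_eq_cube)
qed

section \<open>Assembly of the two cases\<close>

theorem theorem1p9:
  fixes n :: nat and S :: "nat set" and \<tau> \<sigma> q x :: complex
  assumes "n > 0"
    and "symmetric_reps n S"
    and "q = exp (2 * pi * \<i> * \<tau>)"
    and "norm q < 1"
    and "x = exp (pi * \<i> * \<sigma>) - exp (- (pi * \<i> * \<sigma>))"
  shows "(n \<notin> S \<longrightarrow>
           (\<lambda>k. (-1) ^ k * A_series S n k q * x ^ (2 * k)) sums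
             (\<Prod>l\<in>S. vartheta_neg (alpha n l) (of_nat n * \<tau>) \<sigma>
                     / vartheta_null (alpha n l) (of_nat n * \<tau>)))
       \<and> (n \<in> S \<longrightarrow>
           (\<lambda>k. (-1) ^ k * A_series S n k q * x ^ (2 * k + 1)) sums
             (- \<i> * ((\<Prod>l\<in>S. vartheta_neg (alpha n l) (of_nat n * \<tau>) \<sigma>)
                / (dedekind_eta (of_nat n * \<tau>) ^ 3
                   * (\<Prod>l\<in>S - {n}. vartheta_null (alpha n l) (of_nat n * \<tau>))))))"
proof -
  define z where "z = exp (2 * pi * \<i> * \<sigma>)"
  define R where "R l = arith_prod q n l z * arith_prod q n l (1 / z) / arith_prod q n l 1 ^ 2" for l
  let ?num = "\<lambda>l. vartheta_neg (alpha n l) (of_nat n * \<tau>) \<sigma>"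
  let ?den = "\<lambda>l. vartheta_null (alpha n l) (of_nat n * \<tau>)"
  note ratio = prod_vartheta_ratio[OF assms(1) _ _ assms(3,4) z_def, folded R_def]
  have S: "S \<subseteq> {1..n}" "finite S"
    using assms(2) finite_subset by (auto simp: symmetric_reps_def)
  have "z \<noteq> 0"
    by (simp add: z_def)
  moreover have "x\<^sup>2 = z + 1 / z - 2"
  proof -
    have "exp (pi * \<i> * \<sigma>) ^ 2 = z" "exp (- (pi * \<i> * \<sigma>)) ^ 2 = 1 / z"
      by (simp_all add: z_def mult_ac flip: exp_of_nat_mult exp_minus inverse_eq_divide)
    then show ?thesis
      unfolding assms(5) by (simp add: power2_diff exp_minus)
  qed
  ultimately have gen: "(\<lambda>k. (-1) ^ k * A_series S n k q * x ^ (2 * k)) sums (\<Prod>l\<in>S. R l)"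
    unfolding R_def power_mult by (intro A_series_generating_function assms S)
  show ?thesis
  proof (intro conjI impI)
    assume "n \<notin> S"
    then show "(\<lambda>k. (-1) ^ k * A_series S n k q * x ^ (2 * k)) sums (\<Prod>l\<in>S. ?num l / ?den l)"
      unfolding ratio[OF assms(2) \<open>n \<notin> S\<close>] by (intro gen)
  next
    assume "n \<in> S"
    \<comment> \<open>The class of \<open>n\<close> is its own negative, so removing it preserves
      symmetry and the first case applies to the remaining classes.\<close>
    have "symmetric_reps n (S - {n})"
    proof -
      have "\<exists>l'\<in>S - {n}. [int l' = - int l] (mod int n)" if "l \<in> S - {n}" for l
      proof (rule bexI[of _ "n - l"])
        have "1 \<le> l" "l \<le> n"
          using S that by auto
        then show "[int (n - l) = - int l] (mod int n)"
          by (simp add: cong_iff_dvd_diff of_nat_diff)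
        show "n - l \<in> S - {n}"
          using symmetric_reps_diff[OF assms(2)] that \<open>1 \<le> l\<close> \<open>l \<le> n\<close> by auto
      qed
      then show ?thesis
        using S by (auto simp: symmetric_reps_def)
    qed
    then have ratio': "(\<Prod>l\<in>S - {n}. ?num l / ?den l) = (\<Prod>l\<in>S - {n}. R l)"
      by (intro ratio) auto
    have "- \<i> * ((\<Prod>l\<in>S. ?num l) / (dedekind_eta (of_nat n * \<tau>) ^ 3 * (\<Prod>l\<in>S - {n}. ?den l)))
        = (- \<i> * (?num n / dedekind_eta (of_nat n * \<tau>) ^ 3)) * (\<Prod>l\<in>S - {n}. ?num l / ?den l)"
      using S \<open>n \<in> S\<close> by (simp add: prod.remove[of S n] prod_dividef)
    also have "\<dots> = x * R n * (\<Prod>l\<in>S - {n}. R l)"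
      using vartheta_neg_div_dedekind_eta[OF assms(1,3,4) z_def] unfolding ratio' assms(5) R_def by simp
    also have "\<dots> = (\<Prod>l\<in>S. R l) * x"
      using S \<open>n \<in> S\<close> by (simp add: prod.remove[of S n])
    \<comment> \<open>The expansion \<open>gen\<close> covers all of \<open>S\<close>, including
      \<open>n\<close>; multiplying it by \<open>x\<close> gives the odd powers.\<close>
    finally show "(\<lambda>k. (-1) ^ k * A_series S n k q * x ^ (2 * k + 1)) sums
        (- \<i> * ((\<Prod>l\<in>S. ?num l) / (dedekind_eta (of_nat n * \<tau>) ^ 3 * (\<Prod>l\<in>S - {n}. ?den l))))"
      using sums_mult2[OF gen, of x] by (simp add: mult_ac)
  qed
qed

end
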